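(* The conditions $M_H<1$ and $N_H<1$ are not comparable: there exists $H\in C^1(\mathbb{R}^2)$ with $M_H<1$ and $N_H\ge 1$, and there exists $H\in C^1(\mathbb{R}^2)$ with $N_H<1$ and $M_H\ge 1$.
   Context: For a real-valued $H\in C^1(\mathbb{R}^2)$, $$M_H:=\sup_{z\in\mathbb{R}^2}|(\nabla H(z)\cdot z)z|,\qquad N_H:=\frac{1}{\sqrt{4\pi}}\Big(\int_{\mathbb{R}^2}|\nabla H(z)\cdot z|^2\,dz\Big)^{1/2},$$ both with values in $[0,\infty]$. *)

theory Defs
  imports "HOL-Analysis.Analysis"
begin

definition gradient :: "(real^2 \<Rightarrow> real) \<Rightarrow> real^2 \<Rightarrow> real^2"
  where "gradient H z = (THE D. GDERIV H z :> D)"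

definition C1_plane :: "(real^2 \<Rightarrow> real) \<Rightarrow> bool"
  where "C1_plane H \<longleftrightarrow> (\<forall>z. H differentiable (at z)) \<and> continuous_on UNIV (gradient H)"

(* The square root on [0,\<infinity>]; enn2real sends \<infinity> to 0, hence the case distinction. *)
definition ennsqrt :: "ennreal \<Rightarrow> ennreal"
  where "ennsqrt x = (if x = \<infinity> then \<infinity> else ennreal (sqrt (enn2real x)))"

definition M_of :: "(real^2 \<Rightarrow> real) \<Rightarrow> ennreal"
  where "M_of H = (SUP z. ennreal (norm ((gradient H z \<bullet> z) *\<^sub>R z)))"

definition N_of :: "(real^2 \<Rightarrow> real) \<Rightarrow> ennreal"
  where "N_of H = ennreal (1 / sqrt (4 * pi)) *
    ennsqrt (\<integral>\<^sup>+ z. ennreal (\<bar>gradient H z \<bullet> z\<bar>\<^sup>2) \<partial>lborel)"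

lemma gradient_eqI:
  assumes "GDERIV H z :> D"
  shows "gradient H z = D"
  unfolding gradient_def
proof (rule the_equality)
  show "GDERIV H z :> D" by (rule assms)
next
  fix D' assume "GDERIV H z :> D'"
  then have "(\<lambda>h. h \<bullet> D') = (\<lambda>h. h \<bullet> D)"
    using assms has_derivative_unique unfolding gderiv_def by blast
  then show "D' = D"
    by (metis vector_eq_ldot)
qed

lemma GDERIV_gradient:
  assumes "H differentiable (at z)"
  shows "GDERIV H z :> gradient H z"
proof -
  obtain f where f: "(H has_derivative f) (at z)"
    using assms unfolding differentiable_def by blast
  interpret linear f
    using f by (rule has_derivative_linear)
  have "f = (\<lambda>h. h \<bullet> adjoint f 1)"
    using adjoint_works[OF linear_axioms] by (simp add: fun_eq_iff)
  then have "GDERIV H z :> adjoint f 1"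
    using f unfolding gderiv_def by metis
  then show ?thesis
    by (simp add: gradient_eqI)
qed

end

theory Submission
  imports Defs
begin

text \<open>Both examples rest on how \<open>g z = \<nabla>H(z) \<bullet> z\<close> enters the two quantities. If \<open>g\<close> behaves
  like \<open>1 / (2 |z|)\<close> at infinity, as for \<open>H(z) = - 1 / (2 sqrt (1 + |z|^2))\<close>, then \<open>|g z| |z|\<close>
  stays below \<open>1/2\<close>, while the integral of \<open>g^2\<close> diverges logarithmically. Conversely, a bump of
  width \<open>\<epsilon>\<close> and height of order \<open>\<epsilon>\<close> centred at a unit vector has \<open>g\<close> of order 1, so \<open>M_H\<close> is of
  order 1, while \<open>N_H\<close> is of order \<open>\<epsilon>\<close>.\<close>

section \<open>Criteria for \<open>N_of\<close>, \<open>M_of\<close> and C^1 regularity\<close>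

text \<open>Squaring absorbs the normalising factor, so that only the integral has to be compared
  with \<open>4 * pi\<close>. If the integral is infinite, both sides are false.\<close>

lemma N_of_less_1_iff:
  "N_of H < 1 \<longleftrightarrow> (\<integral>\<^sup>+ z. ennreal (\<bar>gradient H z \<bullet> z\<bar>\<^sup>2) \<partial>lborel) < ennreal (4 * pi)"
proof -
  define I where "I = (\<integral>\<^sup>+ z. ennreal (\<bar>gradient H z \<bullet> z\<bar>\<^sup>2) \<partial>lborel)"
  have N: "N_of H = ennreal (1 / sqrt (4 * pi)) * ennsqrt I"
    by (simp add: N_of_def I_def)
  show ?thesis
  proof (cases I)
    case (real r)
    then have "N_of H = ennreal (sqrt (r / (4 * pi)))"
      by (simp add: N ennsqrt_def ennreal_mult'[symmetric] real_sqrt_divide)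
    then show ?thesis
      using real by (simp only: I_def[symmetric]) (simp add: ennreal_less_iff flip: ennreal_1)
  next
    case top
    then show ?thesis
      by (simp only: I_def[symmetric]) (simp add: N ennsqrt_def ennreal_mult_top)
  qed
qed

lemma M_of_ge: "ennreal (norm ((gradient H z \<bullet> z) *\<^sub>R z)) \<le> M_of H"
  unfolding M_of_def by (rule SUP_upper) simp

lemma C1_planeI:
  assumes "\<And>z. GDERIV H z :> D z" and "continuous_on UNIV D"
  shows "C1_plane H" and "gradient H = D"
proof -
  show "gradient H = D"
    using assms(1) gradient_eqI by blast
  then show "C1_plane H"
    using assms unfolding C1_plane_def differentiable_def gderiv_def by metis
qed

section \<open>Areas of squares and the logarithmic divergence at infinity\<close>

lemma emeasure_lborel_square:
  fixes a b :: "real^2"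
  assumes "b - a = vec r" and "0 \<le> r"
  shows "emeasure lborel (box a b) = ennreal (r\<^sup>2)"
    and "emeasure lborel (cbox a b) = ennreal (r\<^sup>2)"
proof -
  have r: "(b - a) \<bullet> e = r" if "e \<in> Basis" for e
    using that unfolding assms(1) by (auto simp: Basis_vec_def inner_axis)
  then have "a \<bullet> e \<le> b \<bullet> e" if "e \<in> Basis" for e
    using that assms(2) by (metis inner_diff_left diff_ge_0_iff_ge)
  moreover have "(\<Prod>e\<in>Basis. (b - a) \<bullet> e) = r\<^sup>2"
    using r by simp
  ultimately show "emeasure lborel (box a b) = ennreal (r\<^sup>2)"
    and "emeasure lborel (cbox a b) = ennreal (r\<^sup>2)"
    by simp_all
qed

lemma norm_sq_vec2: "(norm z)\<^sup>2 = (z $ 1)\<^sup>2 + (z $ 2)\<^sup>2" for z :: "real^2"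
  unfolding power2_norm_eq_inner by (simp add: inner_vec_def sum_2 power2_eq_square)

text \<open>These squares sit along the diagonal, scaled by \<open>2^k\<close>. Their area
  \<open>4^k\<close> is comparable to \<open>(norm z)\<^sup>2\<close> on them, so each contributes a
  fixed amount to the integral of the inverse squared norm.\<close>

lemma dyadic_square_norm_bounds:
  fixes z :: "real^2"
  assumes "z \<in> box (vec (2^k)) (vec (2 * 2^k))"
  shows "1 \<le> (norm z)\<^sup>2" "(norm z)\<^sup>2 \<le> 8 * 4^k"
proof -
  have z: "2^k < z $ i" "z $ i < 2 * 2^k" for i
    using assms by (auto simp: mem_box_cart)
  have sq: "(2^k)\<^sup>2 = (4::real)^k"
    by (simp add: power2_eq_square flip: power_mult_distrib)
  have lo: "4^k \<le> (z $ i)\<^sup>2" for i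
    using power_mono[OF less_imp_le[OF z(1)], of 2] by (simp add: sq)
  have hi: "(z $ i)\<^sup>2 \<le> 4 * 4^k" for i
  proof -
    have "0 \<le> z $ i"
      using z(1)[of i] by (smt (verit) zero_less_power)
    then show ?thesis
      using power_mono[OF less_imp_le[OF z(2)[of i]], of 2] by (simp add: power_mult_distrib sq)
  qed
  show "(norm z)\<^sup>2 \<le> 8 * 4^k"
    using hi[of 1] hi[of 2] by (simp add: norm_sq_vec2)
  have "(1::real) \<le> 4^k" by simp
  then show "1 \<le> (norm z)\<^sup>2"
    unfolding norm_sq_vec2 using lo[of 1] zero_le_power2[of "z $ 2"] by linarith
qed

text \<open>Disjoint dyadic squares take the place of polar coordinates: each of the infinitely many
  squares contributes at least \<open>c / 8\<close>.\<close>

lemma nn_integral_inverse_norm_sq_diverges: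
  fixes f :: "real^2 \<Rightarrow> real"
  assumes c: "0 < c" and f: "\<And>z. 1 \<le> norm z \<Longrightarrow> c / (norm z)\<^sup>2 \<le> f z"
  shows "(\<integral>\<^sup>+ z. ennreal (f z) \<partial>lborel) = \<infinity>"
proof -
  define B :: "nat \<Rightarrow> (real^2) set"
    where "B k = box (vec (2^k)) (vec (2 * 2^k))" for k
  have less: "B m \<inter> B n = {}" if "m < n" for m n
  proof -
    have "(2::real) * 2^m \<le> 2^n"
      using that power_increasing[of "Suc m" n "2::real"] by simp
    then have "\<not> (z $ 1 < 2 * 2^m \<and> 2^n < z $ 1)" for z :: "real^2"
      by linarith
    then show ?thesis
      unfolding B_def by (fastforce simp: mem_box_cart)
  qed
  have disj: "disjoint_family B"
    unfolding disjoint_family_on_def by (metis less Int_commute nat_neq_iff)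
  have [measurable]: "B k \<in> sets borel" for k
    by (simp add: B_def)
  have "\<infinity> = (\<Sum>k::nat. ennreal (c / 8))"
    using c by (simp add: ennreal_mult_top flip: nn_integral_count_space_nat)
  \<comment> \<open>The area \<open>4^k\<close> of \<open>B k\<close> cancels the decay of the lower
    bound \<open>c / (8 * 4^k)\<close>.\<close>
  also have "\<dots> = (\<Sum>k. ennreal (c / (8 * 4^k)) * emeasure lborel (B k))"
    using c by (simp add: B_def emeasure_lborel_square[where r = "2^_"] vec_eq_iff ennreal_mult'[symmetric] power2_eq_square
        flip: power_mult_distrib)
  also have "\<dots> = (\<Sum>k. \<integral>\<^sup>+z. ennreal (c / (8 * 4^k)) * indicator (B k) z \<partial>lborel)"
    by (simp add: nn_integral_cmult_indicator)
  also have "\<dots> = (\<integral>\<^sup>+z. (\<Sum>k. ennreal (c / (8 * 4^k)) * indicator (B k) z) \<partial>lborel)"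
    by (rule nn_integral_suminf[symmetric]) simp
  also have "\<dots> \<le> (\<integral>\<^sup>+z. ennreal (f z) \<partial>lborel)"
  proof (rule nn_integral_mono)
    fix z :: "real^2"
    show "(\<Sum>k. ennreal (c / (8 * 4^k)) * indicator (B k) z) \<le> ennreal (f z)"
    proof (cases "\<exists>k. z \<in> B k")
      case True
      then obtain k where k: "z \<in> B k" by blast
      note b = dyadic_square_norm_bounds[OF k[unfolded B_def]]
      have "0 < (norm z)\<^sup>2"
        using b(1) by linarith
      then have "c / (8 * 4^k) \<le> c / (norm z)\<^sup>2"
        using b c by (intro divide_left_mono mult_pos_pos) auto
      also have "\<dots> \<le> f z"
        using f b(1) power2_le_imp_le[of 1 "norm z"] by simp
      finally show ?thesis
        using suminf_cmult_indicator[OF disj k, of "\<lambda>k. ennreal (c / (8 * 4^k))"]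
        by (simp add: ennreal_leI)
    qed simp
  qed
  finally show ?thesis
    by (simp add: top_unique)
qed

section \<open>Radial functions and a C^1 truncation\<close>

text \<open>Profiles are taken as functions of the squared norm, which is smooth everywhere; the
  norm itself would fail to be differentiable at the centre \<open>p\<close>.\<close>

lemma GDERIV_radial:
  fixes z :: "'a::real_inner"
  assumes "(\<phi> has_real_derivative d) (at ((norm (z - p))\<^sup>2))"
  shows "GDERIV (\<lambda>z. \<phi> ((norm (z - p))\<^sup>2)) z :> (2 * d) *\<^sub>R (z - p)"
proof -
  have "GDERIV (\<lambda>z. (norm (z - p))\<^sup>2) z :> 2 *\<^sub>R (z - p)"
    unfolding power2_norm_eq_inner gderiv_def
    by (auto intro!: derivative_eq_intros simp: inner_commute)
  from GDERIV_DERIV_compose[OF this assms] show ?thesis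
    by (simp add: mult.commute)
qed

text \<open>Squaring removes the kink of \<open>max 0 x\<close> at 0; this makes the compactly
  supported bump of the second example C^1.\<close>

lemma has_real_derivative_max_0_squared:
  "((\<lambda>x. (max 0 x)\<^sup>2) has_real_derivative 2 * max 0 x) (at x)"
proof -
  consider "x < 0" | "x = 0" | "0 < x"
    by linarith
  then show ?thesis
  proof cases
    case 1
    have "((\<lambda>x::real. 0) has_real_derivative 2 * max 0 x) (at x)"
      using 1 by simp
    then show ?thesis
      by (rule has_field_derivative_transform_within_open[of _ _ _ "{..<0}"]) (use 1 in auto)
  next
    case 2
    \<comment> \<open>This includes \<open>h = 0\<close>, where division by zero yields 0.\<close>
    have quot: "(max 0 h)\<^sup>2 / h = max 0 h" for h :: real
      by (auto simp: max_def power2_eq_square)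
    have "((\<lambda>h::real. max 0 h) \<longlongrightarrow> max 0 0) (at 0)"
      by (intro tendsto_intros)
    then show ?thesis
      using 2 by (simp add: DERIV_def quot)
  next
    case 3
    have "((\<lambda>x. x\<^sup>2) has_real_derivative 2 * max 0 x) (at x)"
      using 3 by (auto intro!: derivative_eq_intros)
    then show ?thesis
      by (rule has_field_derivative_transform_within_open[of _ _ _ "{0<..}"]) (use 3 in auto)
  qed
qed

section \<open>The two examples\<close>

lemma M_less_1_N_ge_1:
  defines "H \<equiv> \<lambda>z::real^2. - 1 / (2 * sqrt (1 + (norm z)\<^sup>2))"
  shows "C1_plane H \<and> M_of H < 1 \<and> N_of H \<ge> 1"
proof -
  define s where "s z = sqrt (1 + (norm z)\<^sup>2)" for z :: "real^2"
  define D where "D z = (1 / (2 * s z ^ 3)) *\<^sub>R z" for z :: "real^2"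
  have pos: "1 + (norm z)\<^sup>2 > 0" for z :: "real^2"
    by (smt (verit) zero_le_power2)
  then have s_pos: "s z > 0" and s_sq: "(s z)\<^sup>2 = 1 + (norm z)\<^sup>2" for z
    by (simp_all add: s_def less_imp_le)
  have GD: "GDERIV H z :> D z" for z
  proof -
    have "((\<lambda>t. - 1 / (2 * sqrt (1 + t))) has_real_derivative 1 / (4 * s z ^ 3))
        (at ((norm (z - 0))\<^sup>2))"
      using pos[of z] s_pos[of z]
      by (auto intro!: derivative_eq_intros simp: s_def field_simps power2_eq_square power3_eq_cube)
    from GDERIV_radial[OF this] show ?thesis
      by (simp add: H_def D_def)
  qed
  moreover have "continuous_on UNIV D"
    unfolding D_def s_def
    by (intro continuous_intros) (use s_pos in \<open>auto simp: s_def less_le\<close>)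
  ultimately have C1: "C1_plane H" and grad: "gradient H = D"
    by (rule C1_planeI)+
  have g: "gradient H z \<bullet> z = (norm z)\<^sup>2 / (2 * s z ^ 3)" for z
    by (simp add: grad D_def power2_norm_eq_inner)
  \<comment> \<open>The left-hand side equals \<open>norm z ^ 3 / (2 * s z ^ 3)\<close>.\<close>
  have "norm ((gradient H z \<bullet> z) *\<^sub>R z) \<le> 1 / 2" for z
  proof -
    have "norm z \<le> s z"
      by (simp add: s_def real_le_rsqrt)
    then have "norm z ^ 3 \<le> s z ^ 3"
      by (intro power_mono) auto
    then show ?thesis
      using s_pos[of z] by (simp add: g power2_eq_square power3_eq_cube field_simps)
  qed
  then have "M_of H \<le> ennreal (1 / 2)"
    unfolding M_of_def by (intro SUP_least ennreal_leI)
  also have "\<dots> < 1"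
    by (simp add: ennreal_less_iff del: ennreal_half flip: ennreal_1)
  finally have M: "M_of H < 1" .
  \<comment> \<open>With \<open>t\<close> the squared norm, \<open>1 + t \<le> 2 * t\<close> turns
    the denominator \<open>4 * (1 + t) ^ 3\<close> into \<open>32 * t ^ 3\<close>, whence the
    constant.\<close>
  have "(1 / 32) / (norm z)\<^sup>2 \<le> \<bar>gradient H z \<bullet> z\<bar>\<^sup>2" if "1 \<le> norm z" for z
  proof -
    define t where "t = (norm z)\<^sup>2"
    have t: "1 \<le> t"
      using that by (simp add: t_def)
    have "(s z ^ 3)\<^sup>2 = ((s z)\<^sup>2) ^ 3"
      by (simp flip: power_mult)
    then have "\<bar>gradient H z \<bullet> z\<bar>\<^sup>2 = t\<^sup>2 / (4 * (1 + t) ^ 3)"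
      by (simp add: g s_sq t_def power_divide power_mult_distrib)
    moreover have "(1 + t) ^ 3 \<le> (2 * t) ^ 3"
      using t by (intro power_mono) auto
    then have "t\<^sup>2 / (4 * (2 * t) ^ 3) \<le> t\<^sup>2 / (4 * (1 + t) ^ 3)"
      using t by (intro divide_left_mono) auto
    moreover have "t\<^sup>2 / (4 * (2 * t) ^ 3) = (1 / 32) / t"
      using t by (simp add: field_simps power2_eq_square power3_eq_cube)
    ultimately show ?thesis
      by (simp add: t_def)
  qed
  then have "(\<integral>\<^sup>+ z. ennreal (\<bar>gradient H z \<bullet> z\<bar>\<^sup>2) \<partial>lborel) = \<infinity>"
    by (intro nn_integral_inverse_norm_sq_diverges[of "1 / 32"]) auto
  then have "N_of H \<ge> 1"
    by (subst linorder_not_less[symmetric], subst N_of_less_1_iff) simp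
  with C1 M show ?thesis by blast
qed

text \<open>This is the bump with \<open>\<epsilon> = 1 / 10\<close>: the height is
  \<open>\<epsilon>\<close>, and the factor 100 is \<open>1 / \<epsilon>^2\<close>, which confines
  the support to the disc of radius \<open>\<epsilon>\<close>.\<close>

lemma N_less_1_M_ge_1:
  defines "H \<equiv> \<lambda>z::real^2. (1 / 10) * (max 0 (1 - 100 * (norm (z - axis 1 1))\<^sup>2))\<^sup>2"
  shows "C1_plane H \<and> N_of H < 1 \<and> M_of H \<ge> 1"
proof -
  define p :: "real^2" where "p = axis 1 1"
  define D where "D z = (- 40 * max 0 (1 - 100 * (norm (z - p))\<^sup>2)) *\<^sub>R (z - p)" for z
  have norm_p: "norm p = 1"
    by (simp add: p_def)
  have GD: "GDERIV H z :> D z" for z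
  proof -
    have "((\<lambda>t. (1 / 10) * (max 0 (1 - 100 * t))\<^sup>2) has_real_derivative
        - 20 * max 0 (1 - 100 * t)) (at t)" for t :: real
    proof -
      have "((\<lambda>t. 1 - 100 * t) has_real_derivative - 100) (at t)"
        by (auto intro!: derivative_eq_intros)
      from DERIV_cmult[OF DERIV_chain2[OF has_real_derivative_max_0_squared this], of "1 / 10"]
      show ?thesis by simp
    qed
    from GDERIV_radial[OF this] show ?thesis
      by (simp add: H_def D_def p_def)
  qed
  moreover have "continuous_on UNIV D"
    unfolding D_def by (intro continuous_intros)
  ultimately have C1: "C1_plane H" and grad: "gradient H = D"
    by (rule C1_planeI)+
  define B :: "(real^2) set" where "B = cbox (p - vec (1/10)) (p + vec (1/10))"
  \<comment> \<open>On the disc, \<open>norm (D z) \<le> 4\<close> and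
    \<open>norm z \<le> 11 / 10\<close>; rounding the latter up to \<open>5 / 4\<close> gives the
    product 5. Since the enclosing square \<open>B\<close> has area \<open>1 / 25\<close>, the
    integral is at most 1.\<close>
  have g_le: "\<bar>gradient H z \<bullet> z\<bar>\<^sup>2 \<le> 25 * indicator B z" for z
  proof (cases "norm (z - p) \<le> 1 / 10")
    case True
    have "\<bar>(z - p) $ i\<bar> \<le> 1 / 10" for i
      using component_le_norm_cart[of "z - p" i] True by linarith
    then have "p $ i - 1 / 10 \<le> z $ i \<and> z $ i \<le> p $ i + 1 / 10" for i
      unfolding vector_minus_component abs_le_iff by (smt (verit))
    then have "z \<in> B"
      by (simp add: B_def mem_box_cart)
    have "norm (D z) = 40 * max 0 (1 - 100 * (norm (z - p))\<^sup>2) * norm (z - p)"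
      by (simp add: D_def)
    also have "\<dots> \<le> 40 * 1 * (1 / 10)"
      using True by (intro mult_mono) auto
    finally have "norm (D z) \<le> 4" by simp
    moreover have "norm z \<le> 5 / 4"
      using True norm_triangle_sub[of z p] norm_p by linarith
    ultimately have "norm (D z) * norm z \<le> 4 * (5 / 4)"
      by (intro mult_mono) auto
    then have "\<bar>D z \<bullet> z\<bar> \<le> 5"
      using Cauchy_Schwarz_ineq2[of "D z" z] by linarith
    from power_mono[OF this, of 2] show ?thesis
      using \<open>z \<in> B\<close> by (simp add: grad)
  next
    case False
    then have "(1 / 10)\<^sup>2 \<le> (norm (z - p))\<^sup>2"
      by (intro power_mono) auto
    then show ?thesis
      by (simp add: grad D_def power2_eq_square)
  qed
  have "(\<integral>\<^sup>+ z. ennreal (\<bar>gradient H z \<bullet> z\<bar>\<^sup>2) \<partial>lborel) \<le> (\<integral>\<^sup>+ z. 25 * indicator B z \<partial>lborel)"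
  proof (rule nn_integral_mono)
    show "ennreal (\<bar>gradient H z \<bullet> z\<bar>\<^sup>2) \<le> 25 * indicator B z" for z
      using ennreal_leI[OF g_le[of z]] by (cases "z \<in> B") auto
  qed
  also have "\<dots> = 25 * emeasure lborel B"
    by (simp add: B_def nn_integral_cmult_indicator)
  also have "\<dots> = ennreal 1"
  proof -
    have "emeasure lborel B = ennreal ((1 / 5)\<^sup>2)"
      unfolding B_def by (rule emeasure_lborel_square) (auto simp: vec_eq_iff)
    moreover have "25 * ennreal ((1 / 5)\<^sup>2) = ennreal (25 * (1 / 5)\<^sup>2)"
      by (subst ennreal_mult) auto
    ultimately show ?thesis
      by (simp add: power2_eq_square)
  qed
  also have "\<dots> < ennreal (4 * pi)"
    using pi_gt3 by (simp add: ennreal_less_iff del: ennreal_1)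
  finally have N: "N_of H < 1"
    by (simp only: N_of_less_1_iff)
  \<comment> \<open>The witness lies half a radius outward from the centre. There the truncated
    factor is \<open>3 / 4\<close>, so \<open>D z\<close> is \<open>- 3 / 2\<close> times
    \<open>p\<close>, and the norm in question is \<open>(3 / 2) * (21 / 20)^2 > 1\<close>.\<close>
  define z where "z = (21 / 20) *\<^sub>R p"
  have z: "z - p = (1 / 20) *\<^sub>R p"
    using scaleR_left_diff_distrib[of "21 / 20" 1 p] by (simp add: z_def)
  have "norm ((gradient H z \<bullet> z) *\<^sub>R z) \<ge> 1"
    unfolding grad D_def z
    using norm_p by (simp add: z_def power_divide dot_square_norm)
  then have "1 \<le> M_of H"
    using M_of_ge[of H z] by (metis ennreal_1 ennreal_leI order_trans)
  with C1 N show ?thesis by blast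
qed

theorem claim1:
  shows "(\<exists>H :: real^2 \<Rightarrow> real. C1_plane H \<and> M_of H < 1 \<and> N_of H \<ge> 1) \<and>
         (\<exists>H :: real^2 \<Rightarrow> real. C1_plane H \<and> N_of H < 1 \<and> M_of H \<ge> 1)"
  using M_less_1_N_ge_1 N_less_1_M_ge_1 by blast

end
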